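(* For every $m \ge 3$, the odd graph $O_m$ has degree $m$, and there exists $G \le \operatorname{Aut}(O_m)$ with $G \cong S_{2m-1}$ such that $O_m$ is $G$-vertex-primitive and $O_m$ contains a $G$-permutable $m$-matching.
   Context: The odd graph $O_m$ has as vertices the $(m-1)$-element subsets of a $(2m-1)$-element set, two vertices being adjacent iff the subsets are disjoint. $O_m$ is $G$-vertex-primitive if $G$ is transitive on vertices and preserves no partition of the vertex set other than the partition into singletons and the one-block partition. A matching $\mathcal{M}$ with $m$ edges is $G$-permutable if the setwise stabilizer $G_{\mathcal{M}}$ induces the full symmetric group $S_m$ on the edges of $\mathcal{M}$. *)

theory Defs
  imports "Graph_Theory.Pair_Digraph" "HOL-Algebra.Sym_Groups" "HOL-Library.Disjoint_Sets"
begin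

text \<open>Undirected simple graphs are represented as symmetric loop-free digraphs (locale
  \<^locale>\<open>pair_graph\<close>); the degree of a vertex is then its out-degree.\<close>

definition odd_graph :: "nat \<Rightarrow> 'a set \<Rightarrow> 'a set pair_pre_digraph" where
  "odd_graph m X =
    \<lparr>pverts = {A. A \<subseteq> X \<and> card A = m - 1},
     parcs = {(A, B). A \<subseteq> X \<and> card A = m - 1 \<and> B \<subseteq> X \<and> card B = m - 1 \<and> A \<inter> B = {}}\<rparr>"

lemma pair_graph_odd_graph:
  assumes "finite X" and "m \<ge> 2"
  shows "pair_graph (odd_graph m X)"
proof
  have "pverts (odd_graph m X) \<subseteq> Pow X" "parcs (odd_graph m X) \<subseteq> Pow X \<times> Pow X"
    by (auto simp: odd_graph_def)
  moreover have "finite (Pow X)" "finite (Pow X \<times> Pow X)"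
    using assms by simp_all
  ultimately show "finite (pverts (odd_graph m X))" "finite (parcs (odd_graph m X))"
    by (blast intro: finite_subset)+
  show "symmetric (with_proj (odd_graph m X))"
    by (auto simp: symmetric_def odd_graph_def intro!: symI)
  fix e assume "e \<in> parcs (odd_graph m X)"
  then show "fst e \<in> pverts (odd_graph m X)" "snd e \<in> pverts (odd_graph m X)"
    "fst e \<noteq> snd e"
    using assms by (auto simp: odd_graph_def)
qed

text \<open>As in \<^const>\<open>sym_group\<close>, a permutation of the vertex set is a function on the whole type
  that fixes everything outside it.\<close>

definition aut_group :: "'v pair_pre_digraph \<Rightarrow> ('v \<Rightarrow> 'v) monoid" where
  "aut_group \<Gamma> =
    \<lparr>carrier = {f. f permutes pverts \<Gamma> \<and>
       (\<forall>u \<in> pverts \<Gamma>. \<forall>v \<in> pverts \<Gamma>. (f u, f v) \<in> parcs \<Gamma> \<longleftrightarrow> (u, v) \<in> parcs \<Gamma>)},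
     mult = (\<circ>), one = id\<rparr>"

lemma group_aut_group: "group (aut_group \<Gamma>)"
proof (rule groupI)
  fix f assume f: "f \<in> carrier (aut_group \<Gamma>)"
  then have p: "f permutes pverts \<Gamma>"
    and a: "\<And>u v. u \<in> pverts \<Gamma> \<Longrightarrow> v \<in> pverts \<Gamma> \<Longrightarrow> (f u, f v) \<in> parcs \<Gamma> \<longleftrightarrow> (u, v) \<in> parcs \<Gamma>"
    by (auto simp: aut_group_def)
  have "(inv' f u, inv' f v) \<in> parcs \<Gamma> \<longleftrightarrow> (u, v) \<in> parcs \<Gamma>"
    if "u \<in> pverts \<Gamma>" "v \<in> pverts \<Gamma>" for u v
    using a[of "inv' f u" "inv' f v"] that permutes_in_image[OF permutes_inv[OF p]]
    by (simp add: permutes_inverses[OF p])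
  then have "inv' f \<in> carrier (aut_group \<Gamma>)"
    using permutes_inv[OF p] by (simp add: aut_group_def)
  moreover have "inv' f \<otimes>\<^bsub>aut_group \<Gamma>\<^esub> f = \<one>\<^bsub>aut_group \<Gamma>\<^esub>"
    using permutes_inv_o(2)[OF p] by (simp add: aut_group_def)
  ultimately show "\<exists>g \<in> carrier (aut_group \<Gamma>). g \<otimes>\<^bsub>aut_group \<Gamma>\<^esub> f = \<one>\<^bsub>aut_group \<Gamma>\<^esub>"
    by blast
qed (auto simp: aut_group_def permutes_compose permutes_id permutes_in_image comp_assoc)

definition vertex_primitive :: "'v pair_pre_digraph \<Rightarrow> ('v \<Rightarrow> 'v) set \<Rightarrow> bool" where
  "vertex_primitive \<Gamma> G \<longleftrightarrow>
    (\<forall>u \<in> pverts \<Gamma>. \<forall>v \<in> pverts \<Gamma>. \<exists>g \<in> G. g u = v) \<and>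
    (\<forall>P. partition_on (pverts \<Gamma>) P \<and> (\<forall>g \<in> G. (\<lambda>B. g ` B) ` P = P) \<longrightarrow>
       P = (\<lambda>v. {v}) ` pverts \<Gamma> \<or> P = {pverts \<Gamma>})"

definition edge_set :: "'v pair_pre_digraph \<Rightarrow> 'v set set" where
  "edge_set \<Gamma> = {{u, v} | u v. (u, v) \<in> parcs \<Gamma>}"

definition matching :: "'v pair_pre_digraph \<Rightarrow> 'v set set \<Rightarrow> bool" where
  "matching \<Gamma> M \<longleftrightarrow> M \<subseteq> edge_set \<Gamma> \<and> disjoint M"

definition matching_stabilizer :: "('v \<Rightarrow> 'v) set \<Rightarrow> 'v set set \<Rightarrow> ('v \<Rightarrow> 'v) set" where
  "matching_stabilizer G M = {g \<in> G. (\<lambda>e. g ` e) ` M = M}"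

definition induced_perm :: "'v set set \<Rightarrow> ('v \<Rightarrow> 'v) \<Rightarrow> 'v set \<Rightarrow> 'v set" where
  "induced_perm M g = (\<lambda>e. if e \<in> M then g ` e else e)"

definition permutable_matching ::
  "'v pair_pre_digraph \<Rightarrow> ('v \<Rightarrow> 'v) set \<Rightarrow> nat \<Rightarrow> 'v set set \<Rightarrow> bool" where
  "permutable_matching \<Gamma> G m M \<longleftrightarrow>
    matching \<Gamma> M \<and> finite M \<and> card M = m \<and>
    induced_perm M ` matching_stabilizer G M = {p. p permutes M}"

end

theory Submission
  imports Defs
begin

text \<open>The symmetric group on the ground set \<open>X\<close> acts faithfully on the \<open>(m - 1)\<close>-subsets, and we
  take \<open>G\<close> to be its image. Both transitivity and primitivity rest on the fact that any two
  \<open>k\<close>-subsets are connected by exchanging one element at a time. If a block contains distinct sets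
  \<open>C\<close> and \<open>D\<close>, some \<open>x\<close> lies outside \<open>C \<union> D\<close> because \<open>2 (m - 1) < 2 m - 1\<close>. For
  \<open>b \<in> C - D\<close> the transposition \<open>(b x)\<close> fixes \<open>D\<close>, hence the block, and it exchanges \<open>b\<close> for \<open>x\<close>
  in \<open>C\<close>. The stabilizer of \<open>C\<close> fixes the block as well and carries this exchange to every other
  one, so the block is closed under exchanges and is the whole vertex set.

  For the matching, write \<open>X = Y \<union> Z \<union> {x}\<close> with \<open>card Y = m\<close> and \<open>card Z = m - 2\<close>. The edges are
  \<open>{Z \<union> {y}, Y - {y}}\<close> for \<open>y \<in> Y\<close>, and the permutations of \<open>Y\<close> permute them as they
  permute \<open>Y\<close>. They are pairwise disjoint because \<open>Z\<close> is nonempty.\<close>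

section \<open>The action of permutations on k-subsets\<close>

text \<open>Sets outside \<open>V\<close> are left fixed, so that the result can be a permutation of
  \<open>V\<close> in the sense of \<open>permutes\<close>, as \<open>aut_group\<close>
  requires.\<close>

definition subset_action :: "'a set set \<Rightarrow> ('a \<Rightarrow> 'a) \<Rightarrow> 'a set \<Rightarrow> 'a set" where
  "subset_action V \<sigma> = (\<lambda>A. if A \<in> V then \<sigma> ` A else A)"

abbreviation k_subsets :: "nat \<Rightarrow> 'a set \<Rightarrow> 'a set set" where
  "k_subsets k X \<equiv> {A. A \<subseteq> X \<and> card A = k}"

lemma pverts_odd_graph [simp]: "pverts (odd_graph m X) = k_subsets (m - 1) X"
  by (simp add: odd_graph_def)

lemma image_in_k_subsets_iff:
  assumes "\<sigma> permutes X"
  shows "\<sigma> ` A \<in> k_subsets k X \<longleftrightarrow> A \<in> k_subsets k X"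
proof -
  have "\<sigma> ` A \<subseteq> X \<longleftrightarrow> A \<subseteq> X"
    using permutes_in_image[OF assms] by blast
  moreover have "card (\<sigma> ` A) = card A"
    using assms by (intro card_image permutes_inj_on)
  ultimately show ?thesis
    by simp
qed

lemma subset_action_comp:
  assumes "\<tau> permutes X"
  shows "subset_action (k_subsets k X) (\<sigma> \<circ> \<tau>) =
    subset_action (k_subsets k X) \<sigma> \<circ> subset_action (k_subsets k X) \<tau>"
  using image_in_k_subsets_iff[OF assms, of _ k]
  by (auto simp: subset_action_def fun_eq_iff image_comp)

lemma subset_action_permutes:
  assumes "\<sigma> permutes X"
  shows "subset_action (k_subsets k X) \<sigma> permutes k_subsets k X"
proof (rule bij_imp_permutes)
  let ?V = "k_subsets k X"
  have inj: "inj_on (subset_action ?V \<sigma>) ?V"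
    by (rule inj_onI) (simp add: subset_action_def inj_image_eq_iff[OF permutes_inj[OF assms]])
  have "A \<in> subset_action ?V \<sigma> ` ?V" if A: "A \<in> ?V" for A
  proof
    have "\<sigma> ` (inv' \<sigma> ` A) = A"
      using permutes_inv_o(1)[OF assms] by (simp add: image_comp)
    moreover show "inv' \<sigma> ` A \<in> ?V"
      using image_in_k_subsets_iff[OF permutes_inv[OF assms]] A by blast
    ultimately show "A = subset_action ?V \<sigma> (inv' \<sigma> ` A)"
      by (simp add: subset_action_def)
  qed
  moreover have "subset_action ?V \<sigma> A \<in> ?V" if "A \<in> ?V" for A
    using image_in_k_subsets_iff[OF assms] that by (simp add: subset_action_def)
  ultimately show "bij_betw (subset_action ?V \<sigma>) ?V ?V"
    unfolding bij_betw_def using inj by blast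
qed (auto simp: subset_action_def)

text \<open>If \<open>\<sigma>\<close> and \<open>\<tau>\<close> differ at \<open>x\<close>, let
  \<open>y\<close> be the preimage of \<open>\<sigma> x\<close> under \<open>\<tau>\<close>. A
  k-subset that contains \<open>x\<close> but not \<open>y\<close> tells them apart:
  \<open>\<sigma> x\<close> lies in its image under \<open>\<sigma>\<close> but not in its image
  under \<open>\<tau>\<close>. The bound \<open>0 < k\<close> leaves room for \<open>x\<close>, and
  \<open>k < card X\<close> allows \<open>y\<close> to be avoided.\<close>

lemma subset_action_faithful:
  assumes "finite X" "0 < k" "k < card X"
    and \<sigma>: "\<sigma> permutes X" and \<tau>: "\<tau> permutes X"
    and eq: "subset_action (k_subsets k X) \<sigma> = subset_action (k_subsets k X) \<tau>"
  shows "\<sigma> = \<tau>"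
proof (rule ccontr)
  assume "\<sigma> \<noteq> \<tau>"
  then obtain x where x: "\<sigma> x \<noteq> \<tau> x"
    by blast
  then have xX: "x \<in> X"
    using \<sigma> \<tau> by (metis permutes_not_in)
  define y where "y = inv' \<tau> (\<sigma> x)"
  have y: "\<tau> y = \<sigma> x"
    unfolding y_def using \<tau> by (simp add: permutes_inverses)
  then have "y \<noteq> x" "y \<in> X"
    using x xX permutes_in_image[OF \<sigma>, of x] permutes_in_image[OF \<tau>, of y] by auto
  then have "card (X - {x, y}) = card X - 2"
    using xX assms(1) by (simp add: card_Diff_subset)
  then have "k - 1 \<le> card (X - {x, y})"
    using assms(3) by simp
  then obtain B where B: "B \<subseteq> X - {x, y}" "card B = k - 1" and "finite B"
    by (rule obtain_subset_with_card_n)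
  with B have "insert x B \<in> k_subsets k X"
    using xX assms(2) by (subst mem_Collect_eq, subst card_insert_disjoint) auto
  then have "\<sigma> ` insert x B = \<tau> ` insert x B"
    using fun_cong[OF eq, of "insert x B"] by (simp add: subset_action_def)
  then have "\<tau> y \<in> \<tau> ` insert x B"
    using y by auto
  then have "y \<in> insert x B"
    using inj_image_mem_iff[OF permutes_inj[OF \<tau>]] by metis
  with B(1) \<open>y \<noteq> x\<close> show False
    by blast
qed

lemma subset_action_in_aut_group:
  assumes "\<sigma> permutes X"
  shows "subset_action (k_subsets (m - 1) X) \<sigma> \<in> carrier (aut_group (odd_graph m X))"
proof -
  have "\<sigma> ` A \<inter> \<sigma> ` B = {} \<longleftrightarrow> A \<inter> B = {}" for A B
    using permutes_inj[OF assms] by (simp add: image_Int[symmetric])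
  moreover have "\<sigma> ` A \<subseteq> X \<and> card (\<sigma> ` A) = m - 1" if "A \<in> k_subsets (m - 1) X" for A
    using image_in_k_subsets_iff[OF assms, of A "m - 1"] that by simp
  ultimately show ?thesis
    using subset_action_permutes[OF assms, of "m - 1"]
    by (simp add: aut_group_def odd_graph_def) (simp add: subset_action_def)
qed

section \<open>The symmetric group inside the automorphism group\<close>

text \<open>With \<open>k = m - 1\<close> this is the group \<open>G\<close> of the theorem. It is a
  bare set because \<open>subgroup\<close> and \<open>vertex_primitive\<close> both speak of
  carriers.\<close>

definition sym_action :: "nat \<Rightarrow> 'a set \<Rightarrow> ('a set \<Rightarrow> 'a set) set" where
  "sym_action k X = subset_action (k_subsets k X) ` {\<sigma>. \<sigma> permutes X}"

text \<open>\<open>sym_group n\<close> acts on \<open>{1..n}\<close>, so a numbering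
  \<open>f\<close> of \<open>X\<close> first transports it to the permutations of \<open>X\<close>.
  Following this by the action on subsets gives a homomorphism \<open>h\<close> with image
  \<open>sym_action (m - 1) X\<close>. It is injective by faithfulness, since
  \<open>0 < m - 1 < card X\<close>.\<close>

lemma sym_action_subgroup_iso:
  assumes m: "2 \<le> m" "m \<le> card X"
  shows "subgroup (sym_action (m - 1) X) (aut_group (odd_graph m X))"
    and "(aut_group (odd_graph m X))\<lparr>carrier := sym_action (m - 1) X\<rparr> \<cong> sym_group (card X)"
proof -
  define n where "n = card X"
  have fin: "finite X"
    using m by (intro card_ge_0_finite) auto
  obtain f where f: "bij_betw f {1..n} X"
    using fin finite_same_card_bij[of "{1..n}" X] by (auto simp: n_def)
  have f_inj: "inj_on f {1..n}" and f_img: "f ` {1..n} = X"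
    using f by (auto simp: bij_betw_def)
  define \<phi> where "\<phi> = map_permutation {1..n} f"
  have \<phi>_perm: "\<phi> p permutes X" if "p permutes {1..n}" for p
    unfolding \<phi>_def using f that by (rule map_permutation_permutes)
  have \<phi>_inv: "map_permutation X (inv_into {1..n} f) (\<phi> p) = p" if "p permutes {1..n}" for p
    unfolding \<phi>_def
    by (rule map_permutation_compose_inv[OF f that]) (use f_inj in simp)
  have \<phi>_img: "\<phi> ` {p. p permutes {1..n}} = {\<sigma>. \<sigma> permutes X}"
  proof (intro equalityI subsetI)
    fix \<sigma> assume "\<sigma> \<in> {\<sigma>. \<sigma> permutes X}"
    then have \<sigma>: "\<sigma> permutes X"
      by simp
    have "\<phi> (map_permutation X (inv_into {1..n} f) \<sigma>) = \<sigma>"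
      unfolding \<phi>_def
      by (rule map_permutation_compose_inv[OF bij_betw_inv_into[OF f] \<sigma>])
        (use f_img f_inv_into_f in metis)
    moreover have "map_permutation X (inv_into {1..n} f) \<sigma> permutes {1..n}"
      using bij_betw_inv_into[OF f] \<sigma> by (rule map_permutation_permutes)
    ultimately show "\<sigma> \<in> \<phi> ` {p. p permutes {1..n}}"
      by (metis imageI mem_Collect_eq)
  qed (use \<phi>_perm in auto)
  define h where "h = subset_action (k_subsets (m - 1) X) \<circ> \<phi>"
  let ?S = "sym_group n" and ?A = "aut_group (odd_graph m X)"
  have h_img: "h ` carrier ?S = sym_action (m - 1) X"
    unfolding h_def sym_action_def sym_group_def \<phi>_img[symmetric] by (simp add: image_image)
  have mult: "h (p \<circ> q) = h p \<circ> h q" if "p permutes {1..n}" "q permutes {1..n}" for p q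
  proof -
    have "\<phi> (p \<circ> q) = \<phi> p \<circ> \<phi> q"
      unfolding \<phi>_def using f_inj that by (intro map_permutation_compose')
    then show ?thesis
      by (simp add: h_def subset_action_comp[OF \<phi>_perm[OF that(2)]])
  qed
  have hom: "h \<in> hom ?S ?A"
  proof (rule homI)
    show "h p \<in> carrier ?A" if "p \<in> carrier ?S" for p
      using that \<phi>_perm subset_action_in_aut_group by (auto simp: h_def sym_group_def)
    show "h (p \<otimes>\<^bsub>?S\<^esub> q) = h p \<otimes>\<^bsub>?A\<^esub> h q" if "p \<in> carrier ?S" "q \<in> carrier ?S" for p q
      using mult that by (simp add: sym_group_def aut_group_def)
  qed
  then interpret group_hom ?S ?A h
    by (simp add: group_hom_def group_hom_axioms_def sym_group_is_group group_aut_group)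
  show sub: "subgroup (sym_action (m - 1) X) ?A"
    using img_is_subgroup h_img by simp
  have "inj_on h (carrier ?S)"
  proof (rule inj_onI)
    fix p q assume p: "p \<in> carrier ?S" and q: "q \<in> carrier ?S" and eq: "h p = h q"
    then have pq: "p permutes {1..n}" "q permutes {1..n}"
      by (simp_all add: sym_group_def)
    have "\<phi> p = \<phi> q"
      by (rule subset_action_faithful[OF fin _ _ \<phi>_perm \<phi>_perm, of "m - 1"])
        (use m pq eq in \<open>auto simp: h_def\<close>)
    then show "p = q"
      using \<phi>_inv[OF pq(1)] \<phi>_inv[OF pq(2)] by simp
  qed
  then have "h \<in> iso ?S (?A\<lparr>carrier := sym_action (m - 1) X\<rparr>)"
    using hom h_img by (auto simp: iso_def hom_def bij_betw_def)
  then have "?S \<cong> ?A\<lparr>carrier := sym_action (m - 1) X\<rparr>"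
    by (rule is_isoI)
  then show "?A\<lparr>carrier := sym_action (m - 1) X\<rparr> \<cong> sym_group (card X)"
    using group.iso_sym[OF sym_group_is_group] n_def by blast
qed

section \<open>Exchanges, transitivity and primitivity\<close>

text \<open>Induction on the number of elements of \<open>C\<close> missing from the current set
  \<open>A\<close>. If some \<open>x\<close> is missing, equal cardinality forces some
  \<open>a\<close> in \<open>A - C\<close>, and exchanging \<open>a\<close> for \<open>x\<close>
  lowers the number by one.\<close>

lemma k_subsets_exchange_induct [consumes 3, case_names base exchange]:
  assumes "finite X" "B \<in> k_subsets k X" "C \<in> k_subsets k X"
    and base: "P B"
    and exchange: "\<And>A a x. A \<in> k_subsets k X \<Longrightarrow> P A \<Longrightarrow> a \<in> A \<Longrightarrow> x \<in> X - A \<Longrightarrow>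
      P (insert x (A - {a}))"
  shows "P C"
proof -
  have "P A \<Longrightarrow> A \<in> k_subsets k X \<Longrightarrow> card (C - A) = n \<Longrightarrow> P C" for n A
  proof (induction n arbitrary: A)
    case 0
    have finC: "finite C" and finA: "finite A"
      using 0 assms(1,3) finite_subset by auto
    then have "C \<subseteq> A"
      using 0 by auto
    then have "C = A"
      using 0 assms(3) finA by (intro card_subset_eq) auto
    with 0 show ?case
      by simp
  next
    case (Suc n)
    have fin: "finite C" "finite A"
      using Suc assms(1,3) finite_subset by auto
    have card_eq: "card A = card C"
      using Suc.prems assms(3) by simp
    obtain x where x: "x \<in> C - A"
      using Suc.prems(3) by (metis card.empty ex_in_conv nat.distinct(1))
    have "\<not> A \<subseteq> C"
      using card_subset_eq[OF fin(1) _ card_eq] x by blast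
    then obtain a where a: "a \<in> A - C"
      by blast
    let ?A = "insert x (A - {a})"
    have "card ?A = card A"
      using x a fin by (simp add: card_gt_0_iff) (use fin in \<open>metis Suc_pred card_gt_0_iff empty_iff\<close>)
    then have "?A \<in> k_subsets k X"
      using Suc.prems(2) assms(3) x by auto
    moreover have "P ?A"
      using exchange[OF Suc.prems(2,1)] a x assms(3) by auto
    moreover have "C - ?A = (C - A) - {x}"
      using a by auto
    then have "card (C - ?A) = n"
      using x Suc.prems(3) fin by simp
    ultimately show ?case
      using Suc.IH by blast
  qed
  then show ?thesis
    using base assms(2) by blast
qed

lemma transpose_image_exchange:
  assumes "a \<in> A" "x \<notin> A"
  shows "Transposition.transpose a x ` A = insert x (A - {a})"
  using assms by (auto simp: Transposition.transpose_def image_iff split: if_splits)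

lemma sym_action_vertex_primitive:
  assumes "card X = 2 * m - 1" "m \<ge> 1"
  shows "vertex_primitive (odd_graph m X) (sym_action (m - 1) X)"
proof -
  let ?V = "k_subsets (m - 1) X"
  have fin: "finite X"
    using assms by (intro card_ge_0_finite) auto
  have trans: "\<exists>g \<in> sym_action (m - 1) X. g B = C" if B: "B \<in> ?V" and C: "C \<in> ?V" for B C
  proof -
    from fin B C have "\<exists>\<sigma>. \<sigma> permutes X \<and> \<sigma> ` B = C"
    proof (induction C rule: k_subsets_exchange_induct)
      case base
      show ?case
        by (intro exI[of _ id] conjI permutes_id) simp
    next
      case (exchange A a x)
      then obtain \<sigma> where \<sigma>: "\<sigma> permutes X" "\<sigma> ` B = A"
        by blast
      let ?t = "Transposition.transpose a x"
      have "?t permutes X"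
        using exchange by (intro permutes_swap_id) auto
      then have "?t \<circ> \<sigma> permutes X"
        using \<sigma>(1) by (intro permutes_compose)
      moreover have "(?t \<circ> \<sigma>) ` B = insert x (A - {a})"
        unfolding image_comp[symmetric] using \<sigma>(2) transpose_image_exchange[of a A x] exchange by simp
      ultimately show ?case
        by blast
    qed
    then show ?thesis
      using B by (auto simp: sym_action_def subset_action_def)
  qed
  have prim: "P = (\<lambda>v. {v}) ` ?V \<or> P = {?V}"
    if part: "partition_on ?V P" and inv: "\<forall>g \<in> sym_action (m - 1) X. (\<lambda>B. g ` B) ` P = P" for P
  proof -
    have sub: "K \<subseteq> ?V" if "K \<in> P" for K
      using that partition_onD1[OF part] by (simp only: Union_upper)
    have cover: "\<exists>K \<in> P. v \<in> K" if "v \<in> ?V" for v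
      using that partition_onD1[OF part] by (simp only: Union_iff)
    have unique: "K = L" if "K \<in> P" "L \<in> P" "v \<in> K" "v \<in> L" for K L v
      using that partition_onD2[OF part] unfolding disjoint_def by blast
    show ?thesis
    proof (cases "\<forall>K \<in> P. \<exists>v. K = {v}")
      case True
      have "P = (\<lambda>v. {v}) ` ?V"
      proof (intro equalityI subsetI)
        fix K assume "K \<in> P"
        then obtain v where "K = {v}"
          using True by blast
        with sub[OF \<open>K \<in> P\<close>] show "K \<in> (\<lambda>v. {v}) ` ?V"
          by auto
      next
        fix K assume "K \<in> (\<lambda>v. {v}) ` ?V"
        then obtain v where v: "v \<in> ?V" "K = {v}"
          by blast
        then obtain L where "L \<in> P" "v \<in> L"
          using cover[OF v(1)] by blast
        then show "K \<in> P"
          using True v by fastforce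
      qed
      then show ?thesis ..
    next
      case False
      then obtain K where K: "K \<in> P" and nontriv: "\<And>v. K \<noteq> {v}"
        by blast
      have KV: "K \<subseteq> ?V"
        using sub[OF K] .
      have "K \<noteq> {}"
        using K partition_onD3[OF part] by blast
      then obtain B where B: "B \<in> K"
        by blast
      \<comment> \<open>A permutation that fixes one member \<open>D\<close> of \<open>K\<close>
        sends \<open>K\<close> to a part that still contains \<open>D\<close>, hence to
        \<open>K\<close> itself.\<close>
      have block: "\<sigma> ` C \<in> K"
        if \<sigma>: "\<sigma> permutes X" and D: "D \<in> K" "\<sigma> ` D = D" and C: "C \<in> K" for \<sigma> C D
      proof -
        let ?g = "subset_action ?V \<sigma>"
        have g: "?g ` K \<in> P"
          using inv \<sigma> K by (force simp: sym_action_def)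
        have "?g D = D" "?g C = \<sigma> ` C"
          using D C KV by (auto simp: subset_action_def)
        then have "D \<in> ?g ` K" "\<sigma> ` C \<in> ?g ` K"
          using imageI[OF D(1), of ?g] imageI[OF C, of ?g] by (simp_all only:)
        moreover from this(1) have "?g ` K = K"
          using g K D(1) by (intro unique)
        ultimately show ?thesis
          by simp
      qed
      \<comment> \<open>The exchange of \<open>b'\<close> for \<open>x'\<close> is prescribed. First
        some exchange of \<open>b\<close> for \<open>x\<close> that stays in \<open>K\<close> is
        found, then it is moved to the prescribed one.\<close>
      have closed: "insert x' (C - {b'}) \<in> K"
        if C: "C \<in> K" and b': "b' \<in> C" and x': "x' \<in> X - C" for C b' x'
      proof -
        obtain D where D: "D \<in> K" "D \<noteq> C"
          using nontriv[of C] C by blast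
        have CV: "C \<subseteq> X" "card C = m - 1" and DV: "D \<subseteq> X" "card D = m - 1"
          using C D KV by auto
        have finCD: "finite C" "finite D"
          using CV DV fin finite_subset by auto
        have "\<not> C \<subseteq> D"
          using card_subset_eq[OF finCD(2)] CV DV D(2) by metis
        then obtain b where b: "b \<in> C" "b \<notin> D"
          by blast
        \<comment> \<open>Here the size of the ground set enters:
          \<open>2 * (m - 1) < 2 * m - 1\<close>.\<close>
        have "card (C \<union> D) < card X"
          using card_Un_le[of C D] CV DV assms by linarith
        then have "\<not> X \<subseteq> C \<union> D"
          using card_mono[of "C \<union> D" X] finCD by force
        then obtain x where x: "x \<in> X" "x \<notin> C" "x \<notin> D"
          by blast
        have "Transposition.transpose b x ` D = D"
          using b(2) x(3) by (force simp: Transposition.transpose_def)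
        then have "Transposition.transpose b x ` C \<in> K"
          using block[OF permutes_swap_id D(1) _ C] b x CV by blast
        then have bx: "insert x (C - {b}) \<in> K"
          using transpose_image_exchange b x by metis
        \<comment> \<open>Both \<open>b\<close> and \<open>b'\<close> lie in \<open>C\<close>, both
          \<open>x\<close> and \<open>x'\<close> outside it. So \<open>?s\<close> stabilizes
          \<open>C\<close>, and therefore \<open>K\<close>, while sending \<open>b\<close> to
          \<open>b'\<close> and \<open>x\<close> to \<open>x'\<close>.\<close>
        let ?s = "Transposition.transpose b b' \<circ> Transposition.transpose x x'"
        have "?s permutes X"
          using b b' x x' CV by (intro permutes_compose permutes_swap_id) auto
        moreover have sC: "?s ` C = C"
          unfolding image_comp[symmetric] using b b' x x' by (simp add: transpose_image_eq)
        ultimately have "?s ` insert x (C - {b}) \<in> K"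
          using block[OF _ C _ bx] by blast
        moreover have "inj ?s"
          by (intro inj_compose) simp_all
        then have "?s ` (C - {b}) = C - {b'}"
          using b b' x x' sC by (subst image_set_diff) (auto simp: Transposition.transpose_def)
        moreover have "?s x = x'"
          using b b' x x' by (auto simp: Transposition.transpose_def)
        ultimately show ?thesis
          by (simp del: comp_apply)
      qed
      have "C \<in> K" if C: "C \<in> ?V" for C
      proof -
        have BV: "B \<in> ?V"
          using B KV by blast
        from fin BV C show "C \<in> K"
        proof (induction C rule: k_subsets_exchange_induct)
          case base
          show ?case
            by (rule B)
        next
          case (exchange A a x)
          then show ?case
            by (intro closed)
        qed
      qed
      then have KV': "K = ?V"
        using KV by blast
      \<comment> \<open>Any part is nonempty and so meets \<open>K\<close>, which is now the whole
        vertex set.\<close>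
      have "L = K" if L: "L \<in> P" for L
      proof -
        have "L \<noteq> {}" "L \<subseteq> ?V"
          using L partition_onD3[OF part] sub[OF L] by auto
        then obtain v where "v \<in> L" "v \<in> K"
          using KV' by blast
        with L K show ?thesis
          by (intro unique)
      qed
      then have "P = {?V}"
        using K KV' by blast
      then show ?thesis ..
    qed
  qed
  show ?thesis
    unfolding vertex_primitive_def pverts_odd_graph
  proof (intro conjI ballI allI impI)
    show "\<exists>g \<in> sym_action (m - 1) X. g B = C" if "B \<in> ?V" "C \<in> ?V" for B C
      using that by (rule trans)
    show "P = (\<lambda>v. {v}) ` ?V \<or> P = {?V}"
      if "partition_on ?V P \<and> (\<forall>g \<in> sym_action (m - 1) X. (\<lambda>B. g ` B) ` P = P)" for P
      using prim[OF conjunct1[OF that] conjunct2[OF that]] .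
  qed
qed

section \<open>The degree\<close>

text \<open>The neighbours of \<open>A\<close> are the \<open>(m - 1)\<close>-subsets of its
  complement, which has \<open>m\<close> elements, and \<open>m choose (m - 1) = m\<close>.\<close>

lemma out_degree_odd_graph:
  assumes "card X = 2 * m - 1" "m \<ge> 1" and A: "A \<in> pverts (odd_graph m X)"
  shows "out_degree (with_proj (odd_graph m X)) A = m"
proof -
  have fin: "finite X"
    using assms by (intro card_ge_0_finite) auto
  have A': "A \<subseteq> X" "card A = m - 1"
    using A by auto
  have "e \<in> out_arcs (with_proj (odd_graph m X)) A \<longleftrightarrow> e \<in> {A} \<times> k_subsets (m - 1) (X - A)" for e
    using A' by (cases e) (auto simp: odd_graph_def)
  then have "out_arcs (with_proj (odd_graph m X)) A = {A} \<times> k_subsets (m - 1) (X - A)"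
    by (rule Set.set_eqI)
  then have "out_degree (with_proj (odd_graph m X)) A = card (k_subsets (m - 1) (X - A))"
    by (simp only: out_degree_def card_cartesian_product_singleton)
  also have "\<dots> = card (X - A) choose (m - 1)"
    using fin by (intro n_subsets) simp
  also have "card (X - A) = m"
    using A' assms fin by (simp add: card_Diff_subset finite_subset)
  also have "m choose (m - 1) = m"
    using assms(2) binomial_symmetric[of 1 m] by simp
  finally show ?thesis .
qed

section \<open>The permutable matching\<close>

lemma sym_action_permutable_matching:
  assumes cX: "card X = 2 * m - 1" and m: "m \<ge> 3"
  shows "\<exists>M. permutable_matching (odd_graph m X) (sym_action (m - 1) X) m M"
proof -
  let ?V = "k_subsets (m - 1) X"
  have fin: "finite X"
    using assms by (intro card_ge_0_finite) auto
  have "m \<le> card X"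
    using cX m by simp
  then obtain Y where Y: "Y \<subseteq> X" "card Y = m" "finite Y"
    by (rule obtain_subset_with_card_n)
  have "card (X - Y) = m - 1"
    using Y cX by (simp add: card_Diff_subset)
  \<comment> \<open>\<open>Z\<close> leaves out exactly one point of \<open>X - Y\<close>, so that
    adding a point of \<open>Y\<close> to it gives a vertex.\<close>
  then have "m - 2 \<le> card (X - Y)"
    by simp
  then obtain Z where Z: "Z \<subseteq> X - Y" "card Z = m - 2" "finite Z"
    by (rule obtain_subset_with_card_n)
  have Zne: "Z \<noteq> {}"
    using Z(2) m by auto
  define e where "e y = {insert y Z, Y - {y}}" for y
  define M where "M = e ` Y"
  \<comment> \<open>A set \<open>insert y Z\<close> is never of the form \<open>Y - {y'}\<close>,
    because \<open>Z\<close> is nonempty and disjoint from \<open>Y\<close>. So a common vertex has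
    the same form in both edges, and either form determines \<open>y\<close>.\<close>
  have disj: "y = y'" if "y \<in> Y" "y' \<in> Y" "e y \<inter> e y' \<noteq> {}" for y y'
    using that Zne Z(1) unfolding e_def by blast
  have e_inj: "inj_on e Y"
    by (rule inj_onI, rule disj) (auto simp: e_def)
  have arc: "(insert y Z, Y - {y}) \<in> parcs (odd_graph m X)" if "y \<in> Y" for y
  proof -
    have "card (insert y Z) = m - 1"
      using that Z m by (subst card_insert_disjoint) auto
    moreover have "card (Y - {y}) = m - 1"
      using that Y by simp
    moreover have "insert y Z \<inter> (Y - {y}) = {}"
      using Z(1) by auto
    ultimately show ?thesis
      using that Y(1) Z(1) unfolding odd_graph_def by auto
  qed
  have eV: "e y \<subseteq> ?V" if "y \<in> Y" for y
    using arc[OF that] by (auto simp: e_def odd_graph_def)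
  have M_edges: "M \<subseteq> edge_set (odd_graph m X)"
    using arc by (auto simp: M_def e_def edge_set_def)
  have match: "matching (odd_graph m X) M"
    unfolding matching_def using M_edges disj by (auto simp: M_def disjoint_def)
  have card_M: "card M = m" and fin_M: "finite M"
    using e_inj Y by (simp_all add: M_def card_image)
  \<comment> \<open>One inclusion: a stabilizing element is injective on vertices, hence on edges,
    and maps \<open>M\<close> onto itself.\<close>
  have "induced_perm M g permutes M" if g: "g \<in> matching_stabilizer (sym_action (m - 1) X) M" for g
  proof (rule bij_imp_permutes)
    have stab: "(\<lambda>E. g ` E) ` M = M"
      using g by (simp add: matching_stabilizer_def)
    obtain \<sigma> where "\<sigma> permutes X" "g = subset_action ?V \<sigma>"
      using g by (auto simp: matching_stabilizer_def sym_action_def)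
    then have "inj g"
      using subset_action_permutes permutes_inj by blast
    then have "inj_on (induced_perm M g) M"
      by (intro inj_onI) (simp add: induced_perm_def inj_image_eq_iff)
    moreover have "induced_perm M g ` M = M"
      using stab by (simp add: induced_perm_def)
    ultimately show "bij_betw (induced_perm M g) M M"
      by (simp add: bij_betw_def)
  qed (simp add: induced_perm_def)
  moreover have "p \<in> induced_perm M ` matching_stabilizer (sym_action (m - 1) X) M"
    if p: "p permutes M" for p
  proof
    have e_bij: "bij_betw e Y M"
      using e_inj by (simp add: M_def bij_betw_def)
    \<comment> \<open>For the other inclusion, \<open>p\<close> is carried back along the bijection
      \<open>e\<close> to a permutation \<open>q\<close> of \<open>Y\<close>, whose action on
      subsets will induce \<open>p\<close>.\<close>
    define q where "q = map_permutation M (inv_into Y e) p"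
    have q: "q permutes Y"
      unfolding q_def using bij_betw_inv_into[OF e_bij] p by (rule map_permutation_permutes)
    have eq: "e (q y) = p (e y)" if y: "y \<in> Y" for y
    proof -
      have "q (inv_into Y e (e y)) = inv_into Y e (p (e y))"
        unfolding q_def
        by (rule map_permutation_apply)
          (use bij_betw_inv_into[OF e_bij] y in \<open>auto simp: bij_betw_def M_def\<close>)
      then have "q y = inv_into Y e (p (e y))"
        using e_inj y by simp
      moreover have "p (e y) \<in> e ` Y"
        using permutes_in_image[OF p] y by (simp add: M_def)
      ultimately show ?thesis
        by (simp add: f_inv_into_f)
    qed
    define g where "g = subset_action ?V q"
    have gE: "g ` E = p E" if E: "E \<in> M" for E
    proof -
      obtain y where y: "y \<in> Y" "E = e y"
        using E by (auto simp: M_def)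
      \<comment> \<open>\<open>q\<close> fixes every point outside \<open>Y\<close>, in particular
        those of \<open>Z\<close>; hence it takes both ends of \<open>e y\<close> to those of
        \<open>e (q y)\<close>.\<close>
      have "q ` Z = Z"
        using permutes_not_in[OF q] Z(1) by (auto simp: image_iff) (metis Diff_iff subsetD)+
      moreover have "q ` (Y - {y}) = Y - {q y}"
        using permutes_image[OF q] by (simp add: image_set_diff[OF permutes_inj[OF q]])
      ultimately have "(`) q ` e y = e (q y)"
        by (simp add: e_def)
      moreover have "g ` E = (`) q ` E"
        using eV[OF y(1)] y(2) by (intro image_cong) (auto simp: g_def subset_action_def)
      ultimately show ?thesis
        using eq y by simp
    qed
    show "p = induced_perm M g"
      using gE permutes_not_in[OF p] by (auto simp: induced_perm_def fun_eq_iff)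
    have "(\<lambda>E. g ` E) ` M = p ` M"
      using gE by (intro image_cong) auto
    then show "g \<in> matching_stabilizer (sym_action (m - 1) X) M"
      using permutes_image[OF p] permutes_subset[OF q Y(1)]
      by (simp add: matching_stabilizer_def g_def sym_action_def)
  qed
  ultimately have "induced_perm M ` matching_stabilizer (sym_action (m - 1) X) M = {p. p permutes M}"
    by blast
  then show ?thesis
    unfolding permutable_matching_def using match card_M fin_M by blast
qed

theorem theorem3p7:
  fixes m :: nat and X :: "'a set"
  assumes "m \<ge> 3" and "card X = 2 * m - 1"
  shows "(\<forall>v \<in> pverts (odd_graph m X). out_degree (with_proj (odd_graph m X)) v = m) \<and>
    (\<exists>G. subgroup G (aut_group (odd_graph m X)) \<and>
         (aut_group (odd_graph m X))\<lparr>carrier := G\<rparr> \<cong> sym_group (2 * m - 1) \<and>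
         vertex_primitive (odd_graph m X) G \<and>
         (\<exists>M. permutable_matching (odd_graph m X) G m M))"
proof (intro conjI ballI exI[of _ "sym_action (m - 1) X"])
  have bounds: "2 \<le> m" "m \<le> card X" "m \<ge> 1"
    using assms by auto
  show "out_degree (with_proj (odd_graph m X)) v = m" if "v \<in> pverts (odd_graph m X)" for v
    using out_degree_odd_graph[OF assms(2) bounds(3) that] .
  show "subgroup (sym_action (m - 1) X) (aut_group (odd_graph m X))"
    by (rule sym_action_subgroup_iso[OF bounds(1,2)])
  show "(aut_group (odd_graph m X))\<lparr>carrier := sym_action (m - 1) X\<rparr> \<cong> sym_group (2 * m - 1)"
    using sym_action_subgroup_iso(2)[OF bounds(1,2)] assms(2) by simp
  show "vertex_primitive (odd_graph m X) (sym_action (m - 1) X)"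
    by (rule sym_action_vertex_primitive[OF assms(2) bounds(3)])
  show "\<exists>M. permutable_matching (odd_graph m X) (sym_action (m - 1) X) m M"
    by (rule sym_action_permutable_matching[OF assms(2,1)])
qed

end
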